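(* Let $X$ and $Y$ be Banach spaces, let $1\le p<\infty$, and let $Z=X\oplus_p Y$. If $X$ or $Y$ has the Ball Small Combination of Slice Property ($BSCSP$), then $Z$ has $BSCSP$.
   Context: Banach spaces $X,Y$ are real and nontrivial; $B_X$ is the closed unit ball of $X$. $X\oplus_p Y$ is $X\times Y$ with norm $\|(x,y)\|=(\|x\|^p+\|y\|^p)^{1/p}$. A slice of $B_X$ is a set $S(B_X,x^*,\alpha)=\{x\in B_X: x^*(x)>\sup x^*(B_X)-\alpha\}$ with $x^*\in X^*$, $\|x^*\|=1$, $\alpha>0$. A convex combination of slices of $B_X$ is a set $\sum_{i=1}^n\lambda_i S_i=\{\sum_{i=1}^n\lambda_i s_i: s_i\in S_i\}$ where each $S_i$ is a slice of $B_X$, $0\le\lambda_i\le 1$ and $\sum_{i=1}^n\lambda_i=1$. $X$ has $BSCSP$ if $B_X$ has convex combinations of slices of arbitrarily small diameter (for every $\varepsilon>0$ there is one of diameter less than $\varepsilon$). *)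

theory Defs
  imports "HOL-Analysis.Analysis"
begin

(* The norm of the p-sum depends on the real number p, so it cannot be the norm of a type class
   instance on the product type.  All notions are therefore defined for a real vector space with an
   explicitly given norm N.  At N = norm they are the library notions: see slice_wrt_norm_iff,
   diameter_wrt_norm and BSCSP_norm_iff below. *)

definition lp_sum_norm ::
    "real \<Rightarrow> 'a::real_normed_vector \<times> 'b::real_normed_vector \<Rightarrow> real" where
  "lp_sum_norm p z = (norm (fst z) powr p + norm (snd z) powr p) powr (1 / p)"

definition unit_ball_wrt :: "('v::real_vector \<Rightarrow> real) \<Rightarrow> 'v set" where
  "unit_ball_wrt N = {x. N x \<le> 1}"

definition dual_wrt :: "('v::real_vector \<Rightarrow> real) \<Rightarrow> ('v \<Rightarrow> real) set" where
  "dual_wrt N = {f. linear f \<and> (\<exists>K. \<forall>x. \<bar>f x\<bar> \<le> N x * K)}"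

(* As in the definition of onorm; the term at x = 0 is 0 / 0 = 0. *)
definition dual_norm_wrt :: "('v::real_vector \<Rightarrow> real) \<Rightarrow> ('v \<Rightarrow> real) \<Rightarrow> real" where
  "dual_norm_wrt N f = (SUP x. \<bar>f x\<bar> / N x)"

definition slice_of :: "'v set \<Rightarrow> ('v \<Rightarrow> real) \<Rightarrow> real \<Rightarrow> 'v set" where
  "slice_of B f \<alpha> = {x \<in> B. f x > (SUP y\<in>B. f y) - \<alpha>}"

definition ball_slice_wrt :: "('v::real_vector \<Rightarrow> real) \<Rightarrow> 'v set \<Rightarrow> bool" where
  "ball_slice_wrt N S \<longleftrightarrow>
     (\<exists>f \<alpha>. f \<in> dual_wrt N \<and> dual_norm_wrt N f = 1 \<and> \<alpha> > 0 \<and>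
            S = slice_of (unit_ball_wrt N) f \<alpha>)"

definition set_combination ::
    "nat \<Rightarrow> (nat \<Rightarrow> real) \<Rightarrow> (nat \<Rightarrow> 'v::real_vector set) \<Rightarrow> 'v set" where
  "set_combination n w S = {(\<Sum>i<n. w i *\<^sub>R s i) | s. \<forall>i<n. s i \<in> S i}"

definition convex_comb_ball_slices_wrt ::
    "('v::real_vector \<Rightarrow> real) \<Rightarrow> 'v set \<Rightarrow> bool" where
  "convex_comb_ball_slices_wrt N C \<longleftrightarrow>
     (\<exists>n w S. (\<forall>i<n. ball_slice_wrt N (S i)) \<and>
               (\<forall>i<n. 0 \<le> w i \<and> w i \<le> 1) \<and> (\<Sum>i<n. w i) = 1 \<and>
               C = set_combination n w S)"

definition diameter_wrt :: "('v::real_vector \<Rightarrow> real) \<Rightarrow> 'v set \<Rightarrow> real" where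
  "diameter_wrt N S = (if S = {} then 0 else SUP (x, y)\<in>S \<times> S. N (x - y))"

definition BSCSP :: "('v::real_vector \<Rightarrow> real) \<Rightarrow> bool" where
  "BSCSP N \<longleftrightarrow> (\<forall>\<epsilon>>0. \<exists>C. convex_comb_ball_slices_wrt N C \<and> diameter_wrt N C < \<epsilon>)"


lemma unit_ball_wrt_norm: "unit_ball_wrt norm = cball (0::'v::real_normed_vector) 1"
  by (auto simp: unit_ball_wrt_def)

lemma dual_wrt_norm: "dual_wrt norm = {f :: 'v::real_normed_vector \<Rightarrow> real. bounded_linear f}"
  by (auto simp: dual_wrt_def bounded_linear_def bounded_linear_axioms_def)

lemma dual_norm_wrt_norm: "dual_norm_wrt norm f = onorm f"
  by (simp add: dual_norm_wrt_def onorm_def)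

lemma diameter_wrt_norm: "diameter_wrt norm S = diameter S"
  by (simp add: diameter_wrt_def diameter_def dist_norm)

lemma slice_wrt_norm_iff:
  fixes S :: "'v::real_normed_vector set"
  shows "ball_slice_wrt norm S \<longleftrightarrow>
    (\<exists>(f :: 'v \<Rightarrow>\<^sub>L real) \<alpha>. norm f = 1 \<and> \<alpha> > 0 \<and>
       S = {x \<in> cball 0 1. blinfun_apply f x > (SUP y\<in>cball 0 1. blinfun_apply f y) - \<alpha>})" (is "?L \<longleftrightarrow> ?R")
proof
  assume ?L
  then obtain f \<alpha> where *: "bounded_linear f" "onorm f = 1" "\<alpha> > 0" "S = slice_of (cball 0 1) f \<alpha>"
    by (auto simp: ball_slice_wrt_def dual_wrt_norm dual_norm_wrt_norm unit_ball_wrt_norm)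
  show ?R
    using * by (intro exI[of _ "Blinfun f"] exI[of _ \<alpha>])
      (simp add: norm_blinfun.rep_eq bounded_linear_Blinfun_apply slice_of_def)
next
  assume ?R
  then obtain f :: "'v \<Rightarrow>\<^sub>L real" and \<alpha> where
    *: "norm f = 1" "\<alpha> > 0" "S = {x \<in> cball 0 1. blinfun_apply f x > (SUP y\<in>cball 0 1. blinfun_apply f y) - \<alpha>}"
    by blast
  show ?L
    unfolding ball_slice_wrt_def
    using * by (intro exI[of _ "blinfun_apply f"] exI[of _ \<alpha>])
      (simp add: norm_blinfun.rep_eq dual_wrt_norm dual_norm_wrt_norm unit_ball_wrt_norm
        slice_of_def blinfun.bounded_linear_right)
qed

lemma BSCSP_norm_iff:
  "BSCSP (norm :: 'v::real_normed_vector \<Rightarrow> real) \<longleftrightarrow>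
     (\<forall>\<epsilon>>0. \<exists>C :: 'v set. convex_comb_ball_slices_wrt norm C \<and> diameter C < \<epsilon>)"
  by (simp add: BSCSP_def diameter_wrt_norm)


lemma lp_sum_norm_nonneg: "0 \<le> lp_sum_norm p z"
  by (simp add: lp_sum_norm_def)

lemma lp_sum_norm_powr: "p \<ge> 1 \<Longrightarrow> lp_sum_norm p z powr p = norm (fst z) powr p + norm (snd z) powr p"
  by (simp add: lp_sum_norm_def powr_powr)

lemma lp_sum_norm_eq_0_iff: "p \<ge> 1 \<Longrightarrow> lp_sum_norm p z = 0 \<longleftrightarrow> z = 0"
  by (auto simp: lp_sum_norm_def add_nonneg_eq_0_iff prod_eq_iff)

lemma lp_sum_norm_scaleR:
  assumes "p \<ge> 1"
  shows "lp_sum_norm p (c *\<^sub>R z) = \<bar>c\<bar> * lp_sum_norm p z"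
proof -
  have "lp_sum_norm p (c *\<^sub>R z) =
      (\<bar>c\<bar> powr p * (norm (fst z) powr p + norm (snd z) powr p)) powr (1 / p)"
    by (simp add: lp_sum_norm_def powr_mult distrib_left)
  also have "\<dots> = \<bar>c\<bar> * lp_sum_norm p z"
    using assms by (simp add: powr_mult powr_powr lp_sum_norm_def)
  finally show ?thesis .
qed

lemma norm_le_lp_sum_norm:
  assumes "p \<ge> 1"
  shows "norm (fst z) \<le> lp_sum_norm p z" "norm (snd z) \<le> lp_sum_norm p z"
proof -
  have "(norm (fst z) powr p) powr (1 / p) \<le> lp_sum_norm p z"
    unfolding lp_sum_norm_def using assms by (intro powr_mono2) auto
  then show "norm (fst z) \<le> lp_sum_norm p z" using assms by (simp add: powr_powr)
  have "(norm (snd z) powr p) powr (1 / p) \<le> lp_sum_norm p z"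
    unfolding lp_sum_norm_def using assms by (intro powr_mono2) auto
  then show "norm (snd z) \<le> lp_sum_norm p z" using assms by (simp add: powr_powr)
qed

lemma powr_convex_nonneg:
  fixes t a b p :: real
  assumes "p \<ge> 1" "0 < t" "t < 1" "0 \<le> a" "0 \<le> b"
  shows "(t * a + (1 - t) * b) powr p \<le> t * a powr p + (1 - t) * b powr p"
proof -
  have le: "s powr p \<le> s" if "0 \<le> s" "s \<le> 1" for s :: real
    using powr_mono'[of 1 p s] that assms by simp
  consider "a = 0" | "b = 0" | "a > 0" "b > 0" using assms by linarith
  then show ?thesis
  proof cases
    case 1
    then show ?thesis using assms le[of "1 - t"] by (simp add: powr_mult mult_right_mono)
  next
    case 2
    then show ?thesis using assms le[of t] by (simp add: powr_mult mult_right_mono)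
  next
    case 3
    then show ?thesis
      using convex_onD[OF powr_convex[OF assms(1)], of "1 - t" a b] assms by simp
  qed
qed

lemma lp_sum_norm_triangle:
  assumes p: "p \<ge> 1"
  shows "lp_sum_norm p (z + w) \<le> lp_sum_norm p z + lp_sum_norm p w"
proof (cases "z = 0 \<or> w = 0")
  case True
  then show ?thesis by (auto simp: lp_sum_norm_nonneg)
next
  case False
  define a b where "a = lp_sum_norm p z" and "b = lp_sum_norm p w"
  have pos: "a > 0" "b > 0"
    using False lp_sum_norm_eq_0_iff[OF p] lp_sum_norm_nonneg unfolding a_def b_def
    by (metis less_eq_real_def)+
  define t where "t = a / (a + b)"
  have t: "0 < t" "t < 1" "1 - t = b / (a + b)"
    using pos by (auto simp: t_def field_simps)
  have *: "norm (u + v) powr p \<le>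
      (a + b) powr p * (t * (norm u powr p / a powr p) + (1 - t) * (norm v powr p / b powr p))"
    for u v :: "'c::real_normed_vector"
  proof -
    have "norm (u + v) \<le> (a + b) * (t * (norm u / a) + (1 - t) * (norm v / b))"
    proof -
      have "(a + b) * (t * (norm u / a)) = norm u" "(a + b) * ((1 - t) * (norm v / b)) = norm v"
        using pos unfolding t(3) by (simp_all add: t_def)
      then show ?thesis
        using norm_triangle_ineq[of u v] by (simp add: distrib_left)
    qed
    then have "norm (u + v) powr p \<le> ((a + b) * (t * (norm u / a) + (1 - t) * (norm v / b))) powr p"
      using p by (intro powr_mono2) auto
    also have "\<dots> = (a + b) powr p * (t * (norm u / a) + (1 - t) * (norm v / b)) powr p"
      using pos t(1,2) by (intro powr_mult)
    also have "\<dots> \<le> (a + b) powr p * (t * (norm u / a) powr p + (1 - t) * (norm v / b) powr p)"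
      using pos p t by (intro mult_left_mono powr_convex_nonneg) auto
    also have "\<dots> = (a + b) powr p * (t * (norm u powr p / a powr p) + (1 - t) * (norm v powr p / b powr p))"
      using pos by (simp add: powr_divide)
    finally show ?thesis .
  qed
  have "norm (fst (z + w)) powr p + norm (snd (z + w)) powr p \<le>
      (a + b) powr p * (t * ((norm (fst z) powr p + norm (snd z) powr p) / a powr p)
        + (1 - t) * ((norm (fst w) powr p + norm (snd w) powr p) / b powr p))"
    using add_mono[OF *[of "fst z" "fst w"] *[of "snd z" "snd w"]]
    by (simp add: algebra_simps add_divide_distrib)
  also have "\<dots> = (a + b) powr p"
    unfolding lp_sum_norm_powr[OF p, symmetric] a_def[symmetric] b_def[symmetric]
    using pos by simp
  finally have "lp_sum_norm p (z + w) \<le> ((a + b) powr p) powr (1 / p)"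
    unfolding lp_sum_norm_def using p by (intro powr_mono2) auto
  also have "\<dots> = a + b" using pos p by (simp add: powr_powr)
  finally show ?thesis by (simp add: a_def b_def)
qed

(* Together with norm_le_lp_sum_norm: lp_sum_norm p is equivalent to the product norm, so it is
   complete when both factors are. *)
lemma lp_sum_norm_le_sum:
  assumes "p \<ge> 1"
  shows "lp_sum_norm p z \<le> norm (fst z) + norm (snd z)"
  using lp_sum_norm_triangle[OF assms, of "(fst z, 0)" "(0, snd z)"] assms
  by (simp add: lp_sum_norm_def powr_powr)

end

theory Submission
  imports Defs
begin

text \<open>
  Let \<open>X\<close> be the summand with small combinations of slices and let \<open>P\<close> be the projection of \<open>Z\<close> onto
  it. A slice of \<open>B\<^sub>X\<close> given by a norm-one functional \<open>f\<close> lifts to the slice of \<open>B\<^sub>Z\<close> given by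
  \<open>f \<circ> P\<close>. If the lifted slice is thin, \<open>f (P z)\<close> is close to \<open>1\<close> on it, hence so is \<open>norm (P z)\<close>;
  because \<open>p\<close> is finite, the constraint \<open>norm (fst z) powr p + norm (snd z) powr p \<le> 1\<close> then forces
  the other coordinate to be small. So each lifted slice lies in (the old slice) \<open>\<times>\<close> (a small ball),
  and the convex combination with the same weights lies in (the old combination) \<open>\<times>\<close> (a small ball):
  its diameter exceeds the old one by as little as desired.

  The decisive feature of the \<open>p\<close>-sum is that a point of the unit ball whose projection
  nearly has norm one is nearly equal to its projection. The argument is carried out for any
  projection with this property, so that it serves both coordinates.
\<close>

section \<open>Pulling back functionals along a rigid projection\<close>

text \<open>
  Here \<open>P\<close> is a contractive projection of \<open>(V, N)\<close> onto an isometric copy \<open>j ` X\<close> of a normed space \<open>X\<close>.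
  The last assumption fails, for instance, for the coordinate projections of a maximum-norm sum of
  nontrivial spaces: in its unit ball one coordinate can have any norm up to \<open>1\<close> while the other has
  norm \<open>1\<close>.
\<close>

locale rigid_projection =
  fixes N :: "'v::real_vector \<Rightarrow> real"
    and P :: "'v \<Rightarrow> 'a::real_normed_vector"
    and j :: "'a \<Rightarrow> 'v"
  assumes N_triangle: "N (u + v) \<le> N u + N v"
    and N_scaleR: "N (c *\<^sub>R v) = \<bar>c\<bar> * N v"
    and linear_P: "linear P"
    and linear_j: "linear j"
    and P_j: "P (j x) = x"
    and N_j: "N (j x) = norm x"
    and norm_P_le: "norm (P v) \<le> N v"
    and rigid: "\<eta> > 0 \<Longrightarrow>
      \<exists>\<delta>>0. \<forall>v. N v \<le> 1 \<longrightarrow> norm (P v) > 1 - \<delta> \<longrightarrow> N (v - j (P v)) \<le> \<eta>"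
begin

lemma N_sum_le: "N (\<Sum>i\<in>I. g i) \<le> (\<Sum>i\<in>I. N (g i))"
proof (induction I rule: infinite_finite_induct)
  case (insert i I)
  then show ?case using N_triangle[of "g i" "\<Sum>i\<in>I. g i"] by simp
qed (use N_scaleR[of 0 0] in auto)

lemma N_diff_le: "N (u - v) \<le> N u + N v"
  using N_triangle[of u "(-1) *\<^sub>R v"] N_scaleR[of "-1" v] by simp

lemma P_image_unit_ball: "P ` unit_ball_wrt N = cball 0 1"
proof
  show "P ` unit_ball_wrt N \<subseteq> cball 0 1"
    using norm_P_le order_trans by (fastforce simp: unit_ball_wrt_def)
  show "cball 0 1 \<subseteq> P ` unit_ball_wrt N"
  proof
    fix x :: 'a assume "x \<in> cball 0 1"
    then have "j x \<in> unit_ball_wrt N" by (simp add: unit_ball_wrt_def N_j)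
    then show "x \<in> P ` unit_ball_wrt N" using P_j by (metis imageI)
  qed
qed

lemma pullback_in_dual:
  assumes "bounded_linear f"
  shows "f \<circ> P \<in> dual_wrt N"
proof -
  obtain K where K: "K \<ge> 0" "\<And>x. norm (f x) \<le> norm x * K"
    using bounded_linear.nonneg_bounded[OF assms] by blast
  have "\<bar>f (P v)\<bar> \<le> N v * K" for v
    using K(2)[of "P v"] mult_right_mono[OF norm_P_le[of v] K(1)] by simp
  moreover have "linear (f \<circ> P)"
    using linear_compose[OF linear_P bounded_linear.linear[OF assms]] .
  ultimately show ?thesis by (auto simp: dual_wrt_def)
qed

text \<open>Contractivity of \<open>P\<close> gives one inequality; the vectors \<open>j x\<close> recover every quotient of \<open>f\<close>.\<close>

lemma pullback_dual_norm:
  assumes f: "bounded_linear f" and "onorm f = 1"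
  shows "dual_norm_wrt N (f \<circ> P) = 1"
proof -
  have le: "\<bar>f (P v)\<bar> / N v \<le> 1" for v
  proof -
    have "\<bar>f (P v)\<bar> \<le> N v"
      using onorm[OF f, of "P v"] norm_P_le[of v] assms(2) by simp
    then show ?thesis by (cases "N v = 0") (auto simp: divide_le_eq)
  qed
  then have bdd: "bdd_above (range (\<lambda>v. \<bar>f (P v)\<bar> / N v))"
    by (intro bdd_aboveI[where M = 1]) auto
  have "onorm f \<le> (SUP v. \<bar>f (P v)\<bar> / N v)"
    unfolding onorm_def
  proof (rule cSUP_least)
    fix x
    have "norm (f x) / norm x = \<bar>f (P (j x))\<bar> / N (j x)" by (simp add: P_j N_j)
    also have "\<dots> \<le> (SUP v. \<bar>f (P v)\<bar> / N v)" by (rule cSUP_upper[OF UNIV_I bdd])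
    finally show "norm (f x) / norm x \<le> (SUP v. \<bar>f (P v)\<bar> / N v)" .
  qed simp
  moreover have "(SUP v. \<bar>f (P v)\<bar> / N v) \<le> 1" by (rule cSUP_least) (use le in auto)
  ultimately show ?thesis using assms(2) by (simp add: dual_norm_wrt_def)
qed

end

section \<open>Lifting slices and their convex combinations\<close>

text \<open>
  Slices are cut relative to the supremum of \<open>f\<close>, functionals are normalised by that of \<open>\<bar>f\<bar>\<close>. The
  two are related because the ball contains \<open>- x\<close> along with \<open>x\<close>.
\<close>

lemma one_le_SUP_cball_of_onorm_eq_1:
  fixes f :: "'a::real_normed_vector \<Rightarrow> real"
  assumes f: "bounded_linear f" and "onorm f = 1"
  shows "1 \<le> (SUP x\<in>cball 0 1. f x)"
proof -
  interpret f: bounded_linear f by fact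
  have bdd: "bdd_above (f ` cball 0 1)"
  proof (rule bdd_aboveI2[where M = 1])
    fix x :: 'a assume "x \<in> cball 0 1"
    then show "f x \<le> 1" using onorm[OF f, of x] assms(2) by simp
  qed
  have "onorm f \<le> (SUP x\<in>cball 0 1. f x)"
    unfolding onorm_def
  proof (rule cSUP_least)
    fix x
    have up: "f y \<le> (SUP x\<in>cball 0 1. f x)" if "norm y \<le> 1" for y
      using that by (intro cSUP_upper[OF _ bdd]) simp
    have "f (sgn x) \<le> (SUP x\<in>cball 0 1. f x)" "f (- sgn x) \<le> (SUP x\<in>cball 0 1. f x)"
      by (rule up; simp add: norm_sgn)+
    moreover have "f (sgn x) = f x / norm x"
      by (simp add: sgn_div_norm f.scaleR divide_inverse mult.commute)
    ultimately show "norm (f x) / norm x \<le> (SUP x\<in>cball 0 1. f x)"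
      by (simp add: linear_neg[OF f.linear] abs_if)
  qed simp
  then show ?thesis using assms(2) by simp
qed

context rigid_projection
begin

text \<open>
  The lifted slice is cut out by \<open>f \<circ> P\<close>, whose supremum over the ball of \<open>V\<close> is that of \<open>f\<close> over the
  ball of \<open>X\<close>; so projecting it back gives a point of the original slice, as long as it is not
  wider. Making it also narrower than the \<open>\<delta>\<close> of rigidity keeps the remainder small.
\<close>

lemma ball_slice_lift:
  assumes "ball_slice_wrt norm S" and "\<eta> > 0"
  shows "\<exists>T. ball_slice_wrt N T \<and> (\<forall>v\<in>T. P v \<in> S \<and> N (v - j (P v)) \<le> \<eta>)"
proof -
  obtain f \<alpha> where f: "bounded_linear f" "onorm f = 1" and \<alpha>: "\<alpha> > 0"
    and S: "S = slice_of (cball 0 1) f \<alpha>"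
    using assms(1)
    by (auto simp: ball_slice_wrt_def dual_wrt_norm dual_norm_wrt_norm unit_ball_wrt_norm)
  obtain \<delta> where \<delta>: "\<delta> > 0"
    and small: "\<And>v. N v \<le> 1 \<Longrightarrow> norm (P v) > 1 - \<delta> \<Longrightarrow> N (v - j (P v)) \<le> \<eta>"
    using rigid[OF assms(2)] by blast
  define T where "T = slice_of (unit_ball_wrt N) (f \<circ> P) (min \<alpha> \<delta>)"
  have SUP_eq: "(SUP v\<in>unit_ball_wrt N. (f \<circ> P) v) = (SUP x\<in>cball 0 1. f x)"
    by (simp only: image_comp [symmetric] P_image_unit_ball)
  have "P v \<in> S \<and> N (v - j (P v)) \<le> \<eta>" if "v \<in> T" for v
  proof
    have v: "v \<in> unit_ball_wrt N" "f (P v) > (SUP x\<in>cball 0 1. f x) - min \<alpha> \<delta>"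
      using that unfolding T_def slice_of_def SUP_eq by auto
    have "P v \<in> cball 0 1" using v(1) P_image_unit_ball by blast
    then show "P v \<in> S" using v(2) by (simp add: S slice_of_def)
    have "f (P v) \<le> norm (P v)" using onorm[OF f(1), of "P v"] f(2) by simp
    then have "norm (P v) > 1 - \<delta>"
      using v(2) one_le_SUP_cball_of_onorm_eq_1[OF f] by linarith
    then show "N (v - j (P v)) \<le> \<eta>"
      using v(1) small by (simp add: unit_ball_wrt_def)
  qed
  moreover have "ball_slice_wrt N T"
    unfolding ball_slice_wrt_def T_def
    using pullback_in_dual[OF f(1)] pullback_dual_norm[OF f] \<alpha> \<delta>
    by (intro exI[of _ "f \<circ> P"] exI[of _ "min \<alpha> \<delta>"]) simp
  ultimately show ?thesis by blast
qed

text \<open>The remainder \<open>v - j (P v)\<close> is linear in \<open>v\<close>, so the smallness survives convex combinations.\<close>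

lemma convex_comb_ball_slices_lift:
  assumes "convex_comb_ball_slices_wrt norm C" and "\<eta> > 0"
  shows "\<exists>D. convex_comb_ball_slices_wrt N D \<and> (\<forall>v\<in>D. P v \<in> C \<and> N (v - j (P v)) \<le> \<eta>)"
proof -
  obtain n w S where S: "\<And>i. i < n \<Longrightarrow> ball_slice_wrt norm (S i)"
    and w: "\<And>i. i < n \<Longrightarrow> 0 \<le> w i \<and> w i \<le> 1" "(\<Sum>i<n. w i) = 1"
    and C: "C = set_combination n w S"
    using assms(1) unfolding convex_comb_ball_slices_wrt_def by blast
  obtain T where T: "\<And>i. i < n \<Longrightarrow> ball_slice_wrt N (T i)"
    and lift: "\<And>i v. i < n \<Longrightarrow> v \<in> T i \<Longrightarrow> P v \<in> S i \<and> N (v - j (P v)) \<le> \<eta>"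
    using ball_slice_lift[OF S assms(2)] by metis
  have "P v \<in> C \<and> N (v - j (P v)) \<le> \<eta>" if mem: "v \<in> set_combination n w T" for v
  proof
    obtain t where t: "\<And>i. i < n \<Longrightarrow> t i \<in> T i" and v: "v = (\<Sum>i<n. w i *\<^sub>R t i)"
      using mem unfolding set_combination_def by blast
    have Pv: "P v = (\<Sum>i<n. w i *\<^sub>R P (t i))"
      by (simp add: v linear_sum[OF linear_P] linear_scale[OF linear_P])
    then show "P v \<in> C"
      unfolding C set_combination_def using lift t
      by (intro CollectI exI[of _ "\<lambda>i. P (t i)"]) blast
    have "j (P v) = (\<Sum>i<n. w i *\<^sub>R j (P (t i)))"
      by (simp only: Pv linear_sum[OF linear_j] linear_scale[OF linear_j])
    then have "v - j (P v) = (\<Sum>i<n. w i *\<^sub>R (t i - j (P (t i))))"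
      by (simp add: v sum_subtractf scaleR_diff_right)
    then have "N (v - j (P v)) \<le> (\<Sum>i<n. N (w i *\<^sub>R (t i - j (P (t i)))))"
      using N_sum_le by metis
    also have "\<dots> \<le> (\<Sum>i<n. w i * \<eta>)"
      using w(1) lift t by (intro sum_mono) (simp add: N_scaleR mult_left_mono)
    also have "\<dots> = \<eta>" using w(2) by (simp add: sum_distrib_right [symmetric])
    finally show "N (v - j (P v)) \<le> \<eta>" .
  qed
  moreover have "convex_comb_ball_slices_wrt N (set_combination n w T)"
    unfolding convex_comb_ball_slices_wrt_def using T w by blast
  ultimately show ?thesis by blast
qed

end

text \<open>
  Boundedness makes the diameter, a supremum of real numbers, a genuine bound on the distances.
\<close>

lemma convex_comb_ball_slices_subset_cball:
  fixes C :: "'a::real_normed_vector set"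
  assumes "convex_comb_ball_slices_wrt norm C"
  shows "C \<subseteq> cball 0 1"
proof -
  obtain n w S where S: "\<And>i. i < n \<Longrightarrow> ball_slice_wrt norm (S i)"
    and w: "\<And>i. i < n \<Longrightarrow> 0 \<le> w i \<and> w i \<le> 1" "(\<Sum>i<n. w i) = 1"
    and C: "C = set_combination n w S"
    using assms(1) unfolding convex_comb_ball_slices_wrt_def by blast
  have "S i \<subseteq> cball 0 1" if "i < n" for i
    using S[OF that] by (auto simp: ball_slice_wrt_def slice_of_def unit_ball_wrt_def)
  then have "(\<Sum>i<n. w i *\<^sub>R s i) \<in> cball 0 1" if "\<forall>i<n. s i \<in> S i" for s
    using w that by (intro convex_sum) blast+
  then show ?thesis unfolding C set_combination_def by blast
qed

lemma (in rigid_projection) BSCSP_lift: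
  assumes "BSCSP (norm :: 'a \<Rightarrow> real)"
  shows "BSCSP N"
  unfolding BSCSP_def
proof (intro allI impI)
  fix \<epsilon> :: real assume "\<epsilon> > 0"
  then obtain C :: "'a set" where C: "convex_comb_ball_slices_wrt norm C" "diameter C < \<epsilon>"
    using assms unfolding BSCSP_norm_iff by blast
  have bounded: "bounded C"
    using bounded_subset[OF bounded_cball convex_comb_ball_slices_subset_cball[OF C(1)]] .
  \<comment> \<open>The remainders of two points add at most \<open>2 * \<eta>\<close> to their distance, which still leaves a gap
    to \<open>\<epsilon>\<close>.\<close>
  define \<eta> where "\<eta> = (\<epsilon> - diameter C) / 3"
  have "\<eta> > 0" using C(2) by (simp add: \<eta>_def)
  then obtain D where D: "convex_comb_ball_slices_wrt N D"
    and lift: "\<And>v. v \<in> D \<Longrightarrow> P v \<in> C \<and> N (v - j (P v)) \<le> \<eta>"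
    using convex_comb_ball_slices_lift[OF C(1)] by blast
  have dist_le: "N (u - v) \<le> diameter C + 2 * \<eta>" if "u \<in> D" "v \<in> D" for u v
  proof -
    have "u - v = j (P u - P v) + ((u - j (P u)) - (v - j (P v)))"
      by (simp add: linear_diff[OF linear_j])
    then have "N (u - v) \<le> N (j (P u - P v)) + N ((u - j (P u)) - (v - j (P v)))"
      using N_triangle by metis
    also have "\<dots> \<le> norm (P u - P v) + (N (u - j (P u)) + N (v - j (P v)))"
      using N_diff_le by (simp add: N_j)
    also have "norm (P u - P v) \<le> diameter C"
      using diameter_bounded_bound[OF bounded, of "P u" "P v"] lift that by (simp add: dist_norm)
    finally show ?thesis using lift[OF that(1)] lift[OF that(2)] by linarith
  qed
  have "diameter_wrt N D < \<epsilon>"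
  proof (cases "D = {}")
    case True
    then show ?thesis using \<open>\<epsilon> > 0\<close> by (simp add: diameter_wrt_def)
  next
    case False
    then have "diameter_wrt N D \<le> diameter C + 2 * \<eta>"
      unfolding diameter_wrt_def by (auto intro!: cSUP_least dist_le)
    also have "\<dots> < \<epsilon>" using \<open>\<eta> > 0\<close> unfolding \<eta>_def by (simp add: field_simps)
    finally show ?thesis .
  qed
  then show "\<exists>D. convex_comb_ball_slices_wrt N D \<and> diameter_wrt N D < \<epsilon>" using D by blast
qed

section \<open>The coordinate projections of a \<open>p\<close>-sum\<close>

text \<open>
  Rigidity of the \<open>p\<close>-sum: in the unit ball of the plane with the \<open>p\<close>-norm, the second coordinate
  tends to \<open>0\<close> as the first one tends to \<open>1\<close>.
\<close>

lemma lp_unit_ball_second_coordinate_small: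
  fixes p \<eta> :: real
  assumes p: "1 \<le> p" and \<eta>: "\<eta> > 0"
  shows "\<exists>\<delta>>0. \<forall>a\<ge>0. \<forall>b\<ge>0. a powr p + b powr p \<le> 1 \<longrightarrow> a > 1 - \<delta> \<longrightarrow> b \<le> \<eta>"
proof -
  \<comment> \<open>On the unit sphere, \<open>c\<close> is the first coordinate at which the second one equals \<open>\<eta>\<close>;
    for \<open>\<eta> \<ge> 1\<close> there is nothing to arrange, and \<open>c = 0\<close>.\<close>
  define c where "c = max 0 (1 - \<eta> powr p) powr (1 / p)"
  have "max 0 (1 - \<eta> powr p) < 1" using \<eta> by auto
  then have "c < 1 powr (1 / p)"
    unfolding c_def using p by (intro powr_less_mono2) auto
  then have "1 - c > 0" by simp
  moreover have "b \<le> \<eta>"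
    if "a \<ge> 0" "b \<ge> 0" "a powr p + b powr p \<le> 1" "a > 1 - (1 - c)" for a b
  proof -
    have "c powr p \<le> a powr p" using that p by (intro powr_mono2) (auto simp: c_def)
    moreover have "c powr p = max 0 (1 - \<eta> powr p)" using p by (simp add: c_def powr_powr)
    ultimately have "b powr p \<le> \<eta> powr p" using that(3) by simp
    then show ?thesis using p \<eta> that(2) powr_less_mono2[of p \<eta> b] by force
  qed
  ultimately show ?thesis by blast
qed

lemma lp_sum_norm_le_1_iff:
  assumes "1 \<le> p"
  shows "lp_sum_norm p z \<le> 1 \<longleftrightarrow> norm (fst z) powr p + norm (snd z) powr p \<le> 1"
proof -
  have "lp_sum_norm p z \<le> 1 \<longleftrightarrow> lp_sum_norm p z powr p \<le> 1"
    using powr_mono2[of p "lp_sum_norm p z" 1] powr_less_mono2[of p 1 "lp_sum_norm p z"]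
      lp_sum_norm_nonneg[of p z] assms by (cases "lp_sum_norm p z \<le> 1") (simp_all add: not_le)
  then show ?thesis by (simp add: lp_sum_norm_powr[OF assms])
qed

lemma lp_sum_norm_axis:
  assumes "1 \<le> p"
  shows "lp_sum_norm p (x, 0) = norm x" "lp_sum_norm p (0, y) = norm y"
  using assms by (simp_all add: lp_sum_norm_def powr_powr)

lemma rigid_projection_fst:
  assumes p: "1 \<le> p"
  shows "rigid_projection
    (lp_sum_norm p :: 'a::real_normed_vector \<times> 'b::real_normed_vector \<Rightarrow> real) fst (\<lambda>x. (x, 0))"
proof -
  have "\<exists>\<delta>>0. \<forall>z :: 'a \<times> 'b. lp_sum_norm p z \<le> 1 \<longrightarrow> norm (fst z) > 1 - \<delta> \<longrightarrow>
      lp_sum_norm p (z - (fst z, 0)) \<le> \<eta>" if \<eta>: "\<eta> > 0" for \<eta>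
  proof -
    obtain \<delta> where "\<delta> > 0"
      and small: "\<And>a b. a \<ge> 0 \<Longrightarrow> b \<ge> 0 \<Longrightarrow> a powr p + b powr p \<le> 1 \<Longrightarrow> a > 1 - \<delta> \<Longrightarrow> b \<le> \<eta>"
      using lp_unit_ball_second_coordinate_small[OF p \<eta>] by blast
    moreover have "lp_sum_norm p (z - (fst z, 0)) \<le> \<eta>"
      if "lp_sum_norm p z \<le> 1" "norm (fst z) > 1 - \<delta>" for z :: "'a \<times> 'b"
    proof -
      have "z - (fst z, 0) = (0, snd z)" by (simp add: prod_eq_iff)
      then show ?thesis
        using small[of "norm (fst z)" "norm (snd z)"] that
        by (simp add: lp_sum_norm_le_1_iff[OF p] lp_sum_norm_axis[OF p])
    qed
    ultimately show ?thesis by blast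
  qed
  then show ?thesis
    by unfold_locales
      (use p in \<open>auto simp: lp_sum_norm_triangle lp_sum_norm_scaleR lp_sum_norm_axis norm_le_lp_sum_norm\<close>)
qed

lemma rigid_projection_snd:
  assumes p: "1 \<le> p"
  shows "rigid_projection
    (lp_sum_norm p :: 'a::real_normed_vector \<times> 'b::real_normed_vector \<Rightarrow> real) snd (\<lambda>y. (0, y))"
proof -
  have "\<exists>\<delta>>0. \<forall>z :: 'a \<times> 'b. lp_sum_norm p z \<le> 1 \<longrightarrow> norm (snd z) > 1 - \<delta> \<longrightarrow>
      lp_sum_norm p (z - (0, snd z)) \<le> \<eta>" if \<eta>: "\<eta> > 0" for \<eta>
  proof -
    obtain \<delta> where "\<delta> > 0"
      and small: "\<And>a b. a \<ge> 0 \<Longrightarrow> b \<ge> 0 \<Longrightarrow> a powr p + b powr p \<le> 1 \<Longrightarrow> a > 1 - \<delta> \<Longrightarrow> b \<le> \<eta>"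
      using lp_unit_ball_second_coordinate_small[OF p \<eta>] by blast
    moreover have "lp_sum_norm p (z - (0, snd z)) \<le> \<eta>"
      if "lp_sum_norm p z \<le> 1" "norm (snd z) > 1 - \<delta>" for z :: "'a \<times> 'b"
    proof -
      have "z - (0, snd z) = (fst z, 0)" by (simp add: prod_eq_iff)
      then show ?thesis
        using small[of "norm (snd z)" "norm (fst z)"] that
        by (simp add: lp_sum_norm_le_1_iff[OF p] lp_sum_norm_axis[OF p] add.commute)
    qed
    ultimately show ?thesis by blast
  qed
  then show ?thesis
    by unfold_locales
      (use p in \<open>auto simp: lp_sum_norm_triangle lp_sum_norm_scaleR lp_sum_norm_axis norm_le_lp_sum_norm\<close>)
qed

theorem proposition2p12:
  fixes p :: real
  assumes "\<exists>x::'a::banach. x \<noteq> 0"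
    and "\<exists>y::'b::banach. y \<noteq> 0"
    and "1 \<le> p"
    and "BSCSP (norm :: 'a \<Rightarrow> real) \<or> BSCSP (norm :: 'b \<Rightarrow> real)"
  shows "BSCSP (lp_sum_norm p :: 'a \<times> 'b \<Rightarrow> real)"
  using assms(4) rigid_projection.BSCSP_lift[OF rigid_projection_fst[OF assms(3)]]
    rigid_projection.BSCSP_lift[OF rigid_projection_snd[OF assms(3)]]
  by blast

end
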